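(* Let $u$ be a non-negative entire weak solution of $$\operatorname{div}\,\mathfrak a(x,\nabla u)=|x|^\alpha u^m(x)\quad\text{in }\mathbb R^n,$$ with $u(0)=0$, where $\mathfrak a$ satisfies the structural assumptions listed in the context, $0\le m<p-1$ and $\alpha+1+m>0$. Suppose that $$\lim_{|x|\to\infty}\frac{u(x)}{|x|^{1+\frac{1+\alpha+m}{p-1-m}}}=0.$$ Then $u\equiv0$.
   Context: $n\ge2$, $1<p<\infty$, $0<\lambda\le\Lambda<\infty$, $\mathfrak L_0>0$. The vector field $\mathfrak a:\mathbb R^n\times\mathbb R^n\to\mathbb R^n$ is $C^1$ in the gradient variable $\xi$ and, for all $x,y,\xi,\eta\in\mathbb R^n$, $$|\mathfrak a(x,\xi)|+|\partial_\xi\mathfrak a(x,\xi)||\xi|\le\Lambda|\xi|^{p-1},\qquad \lambda|\xi|^{p-2}|\eta|^2\le\langle\partial_\xi\mathfrak a(x,\xi)\eta,\eta\rangle,\qquad \sup_{x\neq y,\ |\xi|\ne0}\frac{|\mathfrak a(x,\xi)-\mathfrak a(y,\xi)|}{\omega(|x-y|)|\xi|^{p-1}}\le\mathfrak L_0,$$ where $\omega:[0,\infty)\to[0,\infty)$ is a modulus of continuity (concave, non-decreasing, $\omega(0)=0$) with $\omega(s)\lesssim s^{1+\sigma}$ for some $\sigma>|\alpha|$. "Entire weak solution" means $u\in W^{1,p}_{loc}(\mathbb R^n)$ and $\int\mathfrak a(x,\nabla u)\cdot\nabla\Psi\,dx=-\int|x|^\alpha u^m\Psi\,dx$ for all compactly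 supported $\Psi\in W^{1,p}(\mathbb R^n)$. *)

theory Defs
  imports "HOL-Analysis.Analysis"
begin

definition locally_integrable :: "(real ^ 'n \<Rightarrow> 'b::euclidean_space) \<Rightarrow> bool" where
  "locally_integrable f \<longleftrightarrow> (\<forall>K. compact K \<longrightarrow> set_integrable lebesgue K f)"

definition Lp_function :: "real \<Rightarrow> (real ^ 'n \<Rightarrow> 'b::euclidean_space) \<Rightarrow> bool" where
  "Lp_function p f \<longleftrightarrow>
     f \<in> borel_measurable lebesgue \<and> integrable lebesgue (\<lambda>x. norm (f x) powr p)"

definition Lp_loc_function :: "real \<Rightarrow> (real ^ 'n \<Rightarrow> 'b::euclidean_space) \<Rightarrow> bool" where
  "Lp_loc_function p f \<longleftrightarrow>
     f \<in> borel_measurable lebesgue \<and>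
     (\<forall>K. compact K \<longrightarrow> set_integrable lebesgue K (\<lambda>x. norm (f x) powr p))"

definition compactly_supported :: "(real ^ 'n \<Rightarrow> real) \<Rightarrow> bool" where
  "compactly_supported f \<longleftrightarrow> (\<exists>K. compact K \<and> (\<forall>x. x \<notin> K \<longrightarrow> f x = 0))"

definition C1_test_function :: "(real ^ 'n \<Rightarrow> real) \<Rightarrow> (real ^ 'n \<Rightarrow> real ^ 'n) \<Rightarrow> bool" where
  "C1_test_function \<phi> D \<longleftrightarrow>
     (\<forall>x. (\<phi> has_derivative (\<lambda>h. D x \<bullet> h)) (at x)) \<and> continuous_on UNIV D \<and>
     compactly_supported \<phi>"

text \<open>First-order weak derivatives are tested against $C^1_c$, as in Gilbarg and Trudinger
  (Section 7.3); by mollification, testing against $C^\infty_c$ gives the same notion.\<close>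

definition weak_gradient :: "(real ^ 'n \<Rightarrow> real) \<Rightarrow> (real ^ 'n \<Rightarrow> real ^ 'n) \<Rightarrow> bool" where
  "weak_gradient u U \<longleftrightarrow>
     locally_integrable u \<and> locally_integrable U \<and>
     (\<forall>\<phi> D. C1_test_function \<phi> D \<longrightarrow>
        (\<forall>i. (\<integral>x. u x * D x $ i \<partial>lebesgue) = - (\<integral>x. U x $ i * \<phi> x \<partial>lebesgue)))"

text \<open>\<open>W1p p u U\<close> and \<open>W1p_loc p u U\<close>: the function \<open>u\<close> lies in $W^{1,p}(\mathbb{R}^n)$,
  respectively $W^{1,p}_{loc}(\mathbb{R}^n)$, and \<open>U\<close> is a representative of its weak gradient
  (which is unique up to null sets).\<close>

definition W1p :: "real \<Rightarrow> (real ^ 'n \<Rightarrow> real) \<Rightarrow> (real ^ 'n \<Rightarrow> real ^ 'n) \<Rightarrow> bool" where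
  "W1p p u U \<longleftrightarrow> Lp_function p u \<and> Lp_function p U \<and> weak_gradient u U"

definition W1p_loc :: "real \<Rightarrow> (real ^ 'n \<Rightarrow> real) \<Rightarrow> (real ^ 'n \<Rightarrow> real ^ 'n) \<Rightarrow> bool" where
  "W1p_loc p u U \<longleftrightarrow> Lp_loc_function p u \<and> Lp_loc_function p U \<and> weak_gradient u U"

definition modulus_of_continuity :: "(real \<Rightarrow> real) \<Rightarrow> bool" where
  "modulus_of_continuity \<omega> \<longleftrightarrow>
     (\<forall>s\<ge>0. 0 \<le> \<omega> s) \<and> \<omega> 0 = 0 \<and> mono_on {0..} \<omega> \<and> concave_on {0..} \<omega>"

text \<open>The structural assumptions on \<open>a\<close>. Derivatives in the gradient variable are required
  only at \<open>\<xi> \<noteq> 0\<close>: for \<open>p < 2\<close> the ellipticity bound is singular at \<open>0\<close> and excludes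
  differentiability there (already for the \<open>p\<close>-Laplacian). The growth bound at \<open>\<xi> = 0\<close>
  amounts to \<open>a x 0 = 0\<close>. The bound on the supremum of
  $|a(x,\xi)-a(y,\xi)| / (\omega(|x-y|)\,|\xi|^{p-1})$ is multiplied out, since \<open>\<omega>\<close> may vanish
  and division by zero yields zero in HOL.\<close>

definition structural_conditions ::
    "real \<Rightarrow> real \<Rightarrow> real \<Rightarrow> real \<Rightarrow> (real \<Rightarrow> real) \<Rightarrow>
      (real ^ 'n \<Rightarrow> real ^ 'n \<Rightarrow> real ^ 'n) \<Rightarrow> bool" where
  "structural_conditions p lam \<Lambda> L0 \<omega> a \<longleftrightarrow>
     (\<forall>x. a x 0 = 0) \<and>
     (\<exists>Da :: real ^ 'n \<Rightarrow> real ^ 'n \<Rightarrow> ((real ^ 'n) \<Rightarrow>\<^sub>L (real ^ 'n)).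
        (\<forall>x. \<forall>\<xi>. \<xi> \<noteq> 0 \<longrightarrow> (a x has_derivative blinfun_apply (Da x \<xi>)) (at \<xi>)) \<and>
        (\<forall>x. continuous_on (- {0}) (Da x)) \<and>
        (\<forall>x. \<forall>\<xi>. \<xi> \<noteq> 0 \<longrightarrow>
           norm (a x \<xi>) + norm (Da x \<xi>) * norm \<xi> \<le> \<Lambda> * norm \<xi> powr (p - 1)) \<and>
        (\<forall>x. \<forall>\<xi>. \<forall>\<eta>. \<xi> \<noteq> 0 \<longrightarrow>
           lam * norm \<xi> powr (p - 2) * (norm \<eta>)\<^sup>2 \<le> blinfun_apply (Da x \<xi>) \<eta> \<bullet> \<eta>)) \<and>
     (\<forall>x y \<xi>. x \<noteq> y \<and> \<xi> \<noteq> 0 \<longrightarrow>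
        norm (a x \<xi> - a y \<xi>) \<le> L0 * (\<omega> (norm (x - y)) * norm \<xi> powr (p - 1)))"

text \<open>Entire weak solutions of \<open>div a(x, \<nabla>u) = |x|\<^sup>\<alpha> u\<^sup>m\<close>. That both integrals exist is part of
  the definition, because the Bochner integral of a non-integrable function is \<open>0\<close> in HOL.
  As \<open>0 powr 0 = 0\<close>, the absorption term for \<open>m = 0\<close> is $|x|^\alpha \chi_{\{u>0\}}$ when
  \<open>u \<ge> 0\<close>, the usual dead-core (obstacle) convention; with $0^0 = 1$ the zero function
  would not be a solution.\<close>

definition entire_weak_solution ::
    "real \<Rightarrow> (real ^ 'n \<Rightarrow> real ^ 'n \<Rightarrow> real ^ 'n) \<Rightarrow> real \<Rightarrow> real \<Rightarrow>
      (real ^ 'n \<Rightarrow> real) \<Rightarrow> bool" where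
  "entire_weak_solution p a \<alpha> m u \<longleftrightarrow>
     (\<exists>U. W1p_loc p u U \<and>
        (\<forall>\<Psi> V. W1p p \<Psi> V \<and> compactly_supported \<Psi> \<longrightarrow>
           integrable lebesgue (\<lambda>x. a x (U x) \<bullet> V x) \<and>
           integrable lebesgue (\<lambda>x. norm x powr \<alpha> * u x powr m * \<Psi> x) \<and>
           (\<integral>x. a x (U x) \<bullet> V x \<partial>lebesgue)
             = - (\<integral>x. norm x powr \<alpha> * u x powr m * \<Psi> x \<partial>lebesgue)))"

end

theory Submission
  imports Defs
begin

text \<open>
  The proof is an energy argument. Put $F = |x|^\alpha u^{m+1}$,
  $I(R) = \int_{B_R} F$ and $\beta = 1 + \frac{1+\alpha+m}{p-1-m}$, so that
  $\beta (p-1-m) = p + \alpha$.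

  Testing the equation with \<open>\<zeta> u\<close>, where \<open>\<zeta>\<close> is a cutoff between \<open>B\<^sub>R\<close> and
  \<open>B\<^bsub>2R\<^esub>\<close>, gives a Caccioppoli inequality in which the absorption term stays on the left:
  $I(R) \le k R^{-p} \int_{B_{2R} \setminus B_R} u^p$ with \<open>k\<close> independent of \<open>R\<close>
  (\<open>ball_energy_bound\<close>). Only the values of \<open>u\<close> far from the origin enter the right-hand side.
  There $u \le \varepsilon |x|^\beta$, and the choice of \<open>\<beta>\<close> is exactly what makes
  $R^{-p} u^p \le 2^p \varepsilon^{p-1-m} F$ on the annulus (\<open>decay_absorption\<close>).
  Hence $I(R) \le \delta I(2R)$ for all large \<open>R\<close>, with \<open>\<delta>\<close> as small as desired.

  Iterating, \<open>I\<close> would have to grow faster than any prescribed power of \<open>R\<close>, whereas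
  $u \le |x|^\beta$ at infinity bounds \<open>I\<close> by a fixed power. So \<open>I\<close> vanishes
  (\<open>doubling_contraction_zero\<close>, \<open>AE_zero_of_ball_integral_contraction\<close>), and with it \<open>F\<close>
  and \<open>u\<close>.
\<close>

section \<open>Cutoffs with gradient bounded by a power of the cutoff\<close>

lemma DERIV_max_0_power:
  fixes s :: real
  assumes "2 \<le> k"
  shows "((\<lambda>s. max 0 s ^ k) has_real_derivative of_nat k * max 0 s ^ (k - 1)) (at s)"
proof -
  consider "s < 0" | "s = 0" | "0 < s" by linarith
  then show ?thesis
  proof cases
    case 1
    have "((\<lambda>s. 0::real) has_real_derivative of_nat k * max 0 s ^ (k - 1)) (at s)"
      using 1 assms by (simp add: power_0_left)
    then show ?thesis
      by (rule has_field_derivative_transform_within_open[of _ _ _ "{..<0}"])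
        (use 1 assms in \<open>auto simp: power_0_left max_def\<close>)
  next
    case 2
    have "max 0 z ^ k = max 0 z ^ (k - 1) * z" for z :: real
      using assms by (cases "0 \<le> z") (auto simp: max_def power_0_left power_eq_if)
    moreover have "isCont (\<lambda>z::real. max 0 z ^ (k - 1)) 0"
      by (intro continuous_intros)
    ultimately show ?thesis
      using 2 assms by (subst DERIV_caratheodory_within) (auto intro!: exI[of _ "\<lambda>z. max 0 z ^ (k - 1)"])
  next
    case 3
    have "((\<lambda>s. s ^ k) has_real_derivative of_nat k * max 0 s ^ (k - 1)) (at s)"
      using 3 by (auto intro!: derivative_eq_intros)
    then show ?thesis
      by (rule has_field_derivative_transform_within_open[of _ _ _ "{0<..}"])
        (use 3 in \<open>auto simp: max_def\<close>)
  qed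
qed

text \<open>Young's inequality will trade $\zeta |\nabla u|^p$ against
  $u^p |\nabla\zeta|^p \zeta^{1-p}$, so \<open>|D\<zeta>|\<close> must be small where \<open>\<zeta>\<close> is:
  $|D\zeta|^p \le (C/R)^p \zeta^{p-1}$. A \<open>q\<close>-th power with $q \ge p$ has this property, since
  $s^{q-1} \le (s^q)^{(p-1)/p}$ for $0 \le s \le 1$.\<close>

lemma cutoff_exists:
  fixes p :: real
  assumes "1 < p"
  obtains C where "0 < C"
    and "\<And>R. 0 < R \<Longrightarrow> \<exists>\<zeta> (D :: real ^ 'n \<Rightarrow> real ^ 'n). C1_test_function \<zeta> D \<and>
      (\<forall>x. 0 \<le> \<zeta> x) \<and> (\<forall>x. norm x \<le> R \<longrightarrow> \<zeta> x = 1) \<and>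
      (\<forall>x. D x \<noteq> 0 \<longrightarrow> R \<le> norm x \<and> norm x \<le> 2 * R) \<and>
      (\<forall>x. norm (D x) \<le> C / R * \<zeta> x powr ((p - 1) / p))"
proof -
  obtain q :: nat where q: "p \<le> q" "2 \<le> q"
    by (metis le_max_iff_disj of_nat_le_iff of_nat_max real_arch_simple order.refl)
  \<comment> \<open>The radial profile in the variable $t = |x|^2/R^2$: \<open>s\<close> is constantly \<open>1\<close> for \<open>t \<le> 1\<close>
    and falls to \<open>0\<close> at \<open>t = 4\<close>, that is at \<open>|x| = 2 R\<close>.\<close>
  define s :: "real \<Rightarrow> real" where "s = (\<lambda>t. 1 - max 0 (t - 1) ^ 2 / 9)"
  define g where "g = (\<lambda>t. max 0 (s t) ^ q)"
  define g' where "g' = (\<lambda>t. q * max 0 (s t) ^ (q - 1) * (- (2 * max 0 (t - 1) / 9)))"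
  have ds: "(s has_real_derivative (- (2 * max 0 (t - 1) / 9))) (at t)" for t
  proof -
    have "((\<lambda>t. t - 1) has_real_derivative 1) (at t)"
      by (auto intro!: derivative_eq_intros)
    moreover have "((\<lambda>s::real. max 0 s ^ 2) has_real_derivative 2 * max 0 (t - 1)) (at (t - 1))"
      using DERIV_max_0_power[of 2 "t - 1"] by simp
    ultimately have "((\<lambda>t. max 0 (t - 1) ^ 2) has_real_derivative 2 * max 0 (t - 1) * 1) (at t)"
      by (rule DERIV_chain2[where f = "\<lambda>s::real. max 0 s ^ 2" and g = "\<lambda>t. t - 1", rotated])
    from DERIV_diff[OF DERIV_const[of 1] DERIV_cdivide[OF this, of 9]] show ?thesis
      unfolding s_def by simp
  qed
  have dg: "(g has_real_derivative g' t) (at t)" for t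
    unfolding g_def g'_def
    by (rule DERIV_chain2[where f = "\<lambda>s. max 0 s ^ q" and g = s, OF DERIV_max_0_power[OF q(2)] ds])
  have g1: "g t = 1" "g' t = 0" if "t \<le> 1" for t
    using that by (auto simp: g_def g'_def s_def)
  have s0: "s t \<le> 0" if "4 \<le> t" for t
  proof -
    have "3 ^ 2 \<le> (t - 1) ^ 2" using that by (intro power_mono) auto
    then show ?thesis using that by (simp add: s_def)
  qed
  have g0: "g t = 0" "g' t = 0" if "4 \<le> t" for t
    using s0[OF that] q by (auto simp: g_def g'_def max_def power_0_left)
  have s1: "s t \<le> 1" for t by (simp add: s_def)
  have g'b: "\<bar>g' t\<bar> \<le> q * g t powr ((p - 1) / p)" for t
  proof (cases "t \<le> 4 \<and> 0 < s t")
    case True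
    have "\<bar>g' t\<bar> = q * s t ^ (q - 1) * (2 * max 0 (t - 1) / 9)"
      using True by (simp add: g'_def abs_mult)
    also have "\<dots> \<le> q * s t ^ (q - 1) * 1"
      using True by (intro mult_left_mono) (auto simp: max_def)
    also have "s t ^ (q - 1) = s t powr (real q - 1)"
      using True q by (subst powr_realpow[symmetric]) (auto simp: of_nat_diff)
    also have "s t powr (real q - 1) \<le> s t powr (q * ((p - 1) / p))"
      using True s1[of t] q assms by (intro powr_mono') (auto simp: field_simps)
    also have "\<dots> = g t powr ((p - 1) / p)"
      using True by (simp add: g_def powr_powr flip: powr_realpow)
    finally show ?thesis by (simp add: mult_left_mono)
  next
    case False
    then have "g' t = 0"
      using s0[of t] q by (auto simp: g'_def max_def power_0_left)
    then show ?thesis by simp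
  qed
  have cg': "continuous_on UNIV g'"
    unfolding g'_def s_def by (intro continuous_intros) auto
  show thesis
  proof (rule that[of "4 * real q"])
    show "0 < 4 * real q" using q by simp
    fix R :: real assume R: "0 < R"
    define \<zeta> where "\<zeta> = (\<lambda>x :: real ^ 'n. g (x \<bullet> x / R\<^sup>2))"
    define D where "D = (\<lambda>x :: real ^ 'n. (g' (x \<bullet> x / R\<^sup>2) * (2 / R\<^sup>2)) *\<^sub>R x)"
    have le1: "x \<bullet> x / R\<^sup>2 \<le> 1 \<longleftrightarrow> norm x \<le> R" for x :: "real ^ 'n"
      using R by (simp add: dot_square_norm abs_le_square_iff[symmetric])
    have le4: "4 \<le> x \<bullet> x / R\<^sup>2 \<longleftrightarrow> 2 * R \<le> norm x" for x :: "real ^ 'n"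
      using R abs_le_square_iff[of "2 * R" "norm x"]
      by (simp add: dot_square_norm field_simps power_mult_distrib)
    have der: "(\<zeta> has_derivative (\<lambda>h. D x \<bullet> h)) (at x)" for x
    proof -
      have "((\<lambda>x. x \<bullet> x / R\<^sup>2) has_derivative (\<lambda>h. (2 / R\<^sup>2) * (x \<bullet> h))) (at x)"
        using R by (auto intro!: derivative_eq_intros simp: fun_eq_iff inner_commute field_simps)
      from this dg[of "x \<bullet> x / R\<^sup>2"] show ?thesis
        unfolding \<zeta>_def D_def has_field_derivative_def
        by (auto dest: has_derivative_compose simp: algebra_simps)
    qed
    have cD: "continuous_on UNIV D"
      unfolding D_def using R
      by (intro continuous_intros continuous_on_compose2[OF cg']) auto
    have "compactly_supported \<zeta>"
      unfolding compactly_supported_def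
      by (rule exI[of _ "cball 0 (2 * R)"]) (auto simp: \<zeta>_def le4 g0)
    moreover have Dsupp: "R \<le> norm x \<and> norm x \<le> 2 * R" if "D x \<noteq> 0" for x
      using that g1(2)[of "x \<bullet> x / R\<^sup>2"] g0(2)[of "x \<bullet> x / R\<^sup>2"] le1[of x] le4[of x]
      by (auto simp: D_def)
    moreover have "norm (D x) \<le> 4 * real q / R * \<zeta> x powr ((p - 1) / p)" for x
    proof (cases "D x = 0")
      case True then show ?thesis using R by simp
    next
      case False
      have "norm (D x) = \<bar>g' (x \<bullet> x / R\<^sup>2)\<bar> * (2 / R\<^sup>2) * norm x"
        by (simp add: D_def abs_mult)
      also have "\<dots> \<le> (q * \<zeta> x powr ((p - 1) / p)) * (2 / R\<^sup>2) * (2 * R)"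
        using g'b[of "x \<bullet> x / R\<^sup>2"] Dsupp[OF False] R by (intro mult_mono) (auto simp: \<zeta>_def)
      also have "\<dots> = 4 * real q / R * \<zeta> x powr ((p - 1) / p)"
        using R by (simp add: field_simps power2_eq_square)
      finally show ?thesis .
    qed
    moreover have "0 \<le> \<zeta> x" for x by (simp add: \<zeta>_def g_def)
    moreover have "\<zeta> x = 1" if "norm x \<le> R" for x
      using that by (simp add: \<zeta>_def g1 le1)
    ultimately show "\<exists>\<zeta> (D :: real ^ 'n \<Rightarrow> real ^ 'n). C1_test_function \<zeta> D \<and>
      (\<forall>x. 0 \<le> \<zeta> x) \<and> (\<forall>x. norm x \<le> R \<longrightarrow> \<zeta> x = 1) \<and>
      (\<forall>x. D x \<noteq> 0 \<longrightarrow> R \<le> norm x \<and> norm x \<le> 2 * R) \<and>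
      (\<forall>x. norm (D x) \<le> 4 * real q / R * \<zeta> x powr ((p - 1) / p))"
      using der cD unfolding C1_test_function_def by blast
  qed
qed

section \<open>Localisation of Sobolev functions\<close>

lemma C1_test_function_support:
  assumes "C1_test_function \<zeta> D"
  obtains K where "compact K" "\<And>x. x \<notin> K \<Longrightarrow> \<zeta> x = 0" "\<And>x. x \<notin> K \<Longrightarrow> D x = 0"
proof -
  obtain K where K: "compact K" "\<And>x. x \<notin> K \<Longrightarrow> \<zeta> x = 0"
    using assms unfolding C1_test_function_def compactly_supported_def by blast
  have "D x = 0" if "x \<notin> K" for x
  proof -
    have "(\<zeta> has_derivative (\<lambda>h. D x \<bullet> h)) (at x)"
      using assms by (simp add: C1_test_function_def)
    moreover have "((\<lambda>x. 0) has_derivative (\<lambda>h. 0)) (at x)" by simp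
    then have "(\<zeta> has_derivative (\<lambda>h. 0)) (at x)"
      by (rule has_derivative_transform_within_open[of _ _ _ _ "- K"])
        (use K that compact_imp_closed in auto)
    ultimately have "(\<lambda>h. D x \<bullet> h) = (\<lambda>h. 0)" by (rule has_derivative_unique)
    then have "D x \<bullet> D x = 0" by meson
    then show ?thesis by simp
  qed
  with K that show thesis by blast
qed

lemma borel_measurable_lebesgue_continuous:
  "continuous_on UNIV f \<Longrightarrow> f \<in> borel_measurable lebesgue"
  by (intro measurable_completion) (simp add: borel_measurable_continuous_onI)

lemma C1_test_function_continuous:
  assumes "C1_test_function \<zeta> D"
  shows "continuous_on UNIV \<zeta>" "continuous_on UNIV D"
proof -
  have "isCont \<zeta> x" for x
    using assms unfolding C1_test_function_def by (meson has_derivative_continuous)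
  then show "continuous_on UNIV \<zeta>" by (simp add: continuous_on_eq_continuous_at)
  show "continuous_on UNIV D" using assms by (simp add: C1_test_function_def)
qed

lemma continuous_compact_support_bounded:
  fixes g :: "'a::topological_space \<Rightarrow> 'b::real_normed_vector"
  assumes "continuous_on UNIV g" "compact K" "\<And>x. x \<notin> K \<Longrightarrow> g x = 0"
  obtains B where "0 \<le> B" "\<And>x. norm (g x) \<le> B"
proof -
  have "bounded (g ` K)"
    using continuous_on_subset[OF assms(1)] assms(2)
    by (intro compact_imp_bounded compact_continuous_image) auto
  then obtain B where "\<And>x. x \<in> K \<Longrightarrow> norm (g x) \<le> B"
    by (auto simp: bounded_iff)
  then have "norm (g x) \<le> max 0 B" for x
    using assms(3)[of x] by (cases "x \<in> K") (auto simp: le_max_iff_disj)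
  with that[of "max 0 B"] show thesis by simp
qed

lemma integrable_continuous_compact_support_mult:
  fixes f :: "real ^ 'n \<Rightarrow> 'b::euclidean_space" and g :: "real ^ 'n \<Rightarrow> real"
  assumes "locally_integrable f" "continuous_on UNIV g" "compact K" "\<And>x. x \<notin> K \<Longrightarrow> g x = 0"
  shows "integrable lebesgue (\<lambda>x. g x *\<^sub>R f x)"
proof -
  obtain B where B: "0 \<le> B" "\<And>x. norm (g x) \<le> B"
    using continuous_compact_support_bounded[OF assms(2-4)] by metis
  have f: "integrable lebesgue (\<lambda>x. indicator K x *\<^sub>R f x)"
    using assms by (auto simp: locally_integrable_def set_integrable_def)
  have eq: "(\<lambda>x. g x *\<^sub>R f x) = (\<lambda>x. g x *\<^sub>R (indicator K x *\<^sub>R f x))"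
    using assms(4) by (auto simp: fun_eq_iff indicator_def)
  show ?thesis unfolding eq
  proof (rule Bochner_Integration.integrable_bound)
    show "integrable lebesgue (\<lambda>x. B *\<^sub>R (indicator K x *\<^sub>R f x))"
      using f by (intro integrable_scaleR_right)
    show "(\<lambda>x. g x *\<^sub>R (indicator K x *\<^sub>R f x)) \<in> borel_measurable lebesgue"
      using borel_measurable_lebesgue_continuous[OF assms(2)] borel_measurable_integrable[OF f]
      by (rule borel_measurable_scaleR)
    show "AE x in lebesgue. norm (g x *\<^sub>R indicat_real K x *\<^sub>R f x)
        \<le> norm (B *\<^sub>R indicat_real K x *\<^sub>R f x)"
      using B by (intro AE_I2) (auto simp: indicator_def intro!: mult_right_mono)
  qed
qed

lemma C1_test_function_mult:
  assumes "C1_test_function \<zeta> D" "C1_test_function \<phi> E"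
  shows "C1_test_function (\<lambda>x. \<zeta> x * \<phi> x) (\<lambda>x. \<zeta> x *\<^sub>R E x + \<phi> x *\<^sub>R D x)"
  unfolding C1_test_function_def
proof (intro conjI allI)
  fix x
  have "(\<zeta> has_derivative (\<lambda>h. D x \<bullet> h)) (at x)" "(\<phi> has_derivative (\<lambda>h. E x \<bullet> h)) (at x)"
    using assms by (auto simp: C1_test_function_def)
  from has_derivative_mult[OF this]
  show "((\<lambda>x. \<zeta> x * \<phi> x) has_derivative (\<lambda>h. (\<zeta> x *\<^sub>R E x + \<phi> x *\<^sub>R D x) \<bullet> h)) (at x)"
    by (simp add: inner_add_left mult.commute)
next
  show "continuous_on UNIV (\<lambda>x. \<zeta> x *\<^sub>R E x + \<phi> x *\<^sub>R D x)"
    using assms by (intro continuous_intros C1_test_function_continuous)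
  show "compactly_supported (\<lambda>x. \<zeta> x * \<phi> x)"
    using assms by (fastforce simp: C1_test_function_def compactly_supported_def)
qed

lemma locally_integrable_continuous_mult:
  fixes f :: "real ^ 'n \<Rightarrow> 'b::euclidean_space" and g :: "real ^ 'n \<Rightarrow> real"
  assumes "locally_integrable f" "continuous_on UNIV g" "compact K" "\<And>x. x \<notin> K \<Longrightarrow> g x = 0"
  shows "locally_integrable (\<lambda>x. g x *\<^sub>R f x)"
  unfolding locally_integrable_def set_integrable_def
proof (intro allI impI)
  fix L :: "(real ^ 'n) set" assume "compact L"
  then have "L \<in> sets lebesgue" by (intro fmeasurableD lmeasurable_compact)
  then show "integrable lebesgue (\<lambda>x. indicat_real L x *\<^sub>R g x *\<^sub>R f x)"
    using integrable_continuous_compact_support_mult[OF assms] by (rule integrable_mult_indicator)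
qed

lemma locally_integrable_component:
  fixes f :: "real ^ 'n \<Rightarrow> real ^ 'm"
  assumes "\<And>i. locally_integrable (\<lambda>x. f x $ i)"
  shows "locally_integrable f"
  unfolding locally_integrable_def set_integrable_def
proof (intro allI impI)
  fix K :: "(real ^ 'n) set" assume "compact K"
  then have "integrable lebesgue (\<lambda>x. (indicator K x * f x $ i) *\<^sub>R axis i (1::real))" for i
    using assms by (intro integrable_scaleR_left) (auto simp: locally_integrable_def set_integrable_def)
  then have "integrable lebesgue (\<lambda>x. \<Sum>i\<in>UNIV. (indicator K x * f x $ i) *\<^sub>R axis i (1::real))"
    by (intro Bochner_Integration.integrable_sum) auto
  moreover have "(\<lambda>x. \<Sum>i\<in>UNIV. (indicator K x * f x $ i) *\<^sub>R axis i (1::real)) = (\<lambda>x. indicator K x *\<^sub>R f x)"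
    by (auto simp: fun_eq_iff vec_eq_iff axis_def if_distrib cong: if_cong)
  ultimately show "integrable lebesgue (\<lambda>x. indicat_real K x *\<^sub>R f x)" by simp
qed

lemma locally_integrable_vec_nth:
  fixes f :: "real ^ 'n \<Rightarrow> real ^ 'm"
  assumes "locally_integrable f"
  shows "locally_integrable (\<lambda>x. f x $ i)"
  unfolding locally_integrable_def set_integrable_def
proof (intro allI impI)
  fix K :: "(real ^ 'n) set" assume "compact K"
  then have "integrable lebesgue (\<lambda>x. indicator K x *\<^sub>R f x)"
    using assms by (simp add: locally_integrable_def set_integrable_def)
  from integrable_bounded_linear[OF bounded_linear_vec_nth this, of i]
  show "integrable lebesgue (\<lambda>x. indicator K x *\<^sub>R f x $ i)" by simp
qed

text \<open>The product rule needs no approximation of \<open>u\<close>: a test function for \<open>\<zeta> u\<close> multiplied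
  by \<open>\<zeta>\<close> is a test function for \<open>u\<close>.\<close>

lemma weak_gradient_mult_test:
  fixes u :: "real ^ 'n \<Rightarrow> real"
  assumes "weak_gradient u U" "C1_test_function \<zeta> D"
  shows "weak_gradient (\<lambda>x. \<zeta> x * u x) (\<lambda>x. \<zeta> x *\<^sub>R U x + u x *\<^sub>R D x)"
  unfolding weak_gradient_def
proof (intro conjI allI impI)
  obtain K where K: "compact K" "\<And>x. x \<notin> K \<Longrightarrow> \<zeta> x = 0" "\<And>x. x \<notin> K \<Longrightarrow> D x = 0"
    using C1_test_function_support[OF assms(2)] by metis
  note cont = C1_test_function_continuous[OF assms(2)]
  have u: "locally_integrable u" and U: "locally_integrable U"
    using assms(1) by (auto simp: weak_gradient_def)
  show "locally_integrable (\<lambda>x. \<zeta> x * u x)"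
    using locally_integrable_continuous_mult[OF u cont(1) K(1,2)] by simp
  have "locally_integrable (\<lambda>x. \<zeta> x *\<^sub>R U x)"
    using locally_integrable_continuous_mult[OF U cont(1) K(1,2)] by simp
  moreover have "locally_integrable (\<lambda>x. u x *\<^sub>R D x)"
  proof (rule locally_integrable_component)
    fix i
    have "continuous_on UNIV (\<lambda>x. D x $ i)" by (intro continuous_intros cont)
    from locally_integrable_continuous_mult[OF u this K(1)] K(3)
    show "locally_integrable (\<lambda>x. (u x *\<^sub>R D x) $ i)"
      by (simp add: mult.commute)
  qed
  ultimately show "locally_integrable (\<lambda>x. \<zeta> x *\<^sub>R U x + u x *\<^sub>R D x)"
    unfolding locally_integrable_def set_integrable_def by (simp add: scaleR_add_right)
  fix \<phi> :: "real ^ 'n \<Rightarrow> real" and E i assume test: "C1_test_function \<phi> E"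
  note cont' = C1_test_function_continuous[OF test]
  have ci: "continuous_on UNIV (\<lambda>x. \<phi> x * D x $ i)" "continuous_on UNIV (\<lambda>x. \<zeta> x * E x $ i)"
      "continuous_on UNIV (\<lambda>x. \<zeta> x * \<phi> x)"
    by (intro continuous_intros cont cont')+
  have i1: "integrable lebesgue (\<lambda>x. (\<phi> x * D x $ i) *\<^sub>R u x)"
    using integrable_continuous_compact_support_mult[OF u ci(1) K(1)] K(3) by simp
  have i2: "integrable lebesgue (\<lambda>x. (\<zeta> x * E x $ i) *\<^sub>R u x)"
    using integrable_continuous_compact_support_mult[OF u ci(2) K(1)] K(2) by simp
  have i3: "integrable lebesgue (\<lambda>x. (\<zeta> x * \<phi> x) *\<^sub>R U x $ i)"
    using integrable_continuous_compact_support_mult[OF locally_integrable_vec_nth[OF U] ci(3) K(1)] K(2)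
    by simp
  have "(\<integral>x. u x * (\<zeta> x *\<^sub>R E x + \<phi> x *\<^sub>R D x) $ i \<partial>lebesgue)
      = - (\<integral>x. U x $ i * (\<zeta> x * \<phi> x) \<partial>lebesgue)"
    using assms(1) C1_test_function_mult[OF assms(2) test] unfolding weak_gradient_def by blast
  moreover have "(\<integral>x. u x * (\<zeta> x *\<^sub>R E x + \<phi> x *\<^sub>R D x) $ i \<partial>lebesgue)
      = (\<integral>x. (\<zeta> x * E x $ i) *\<^sub>R u x \<partial>lebesgue) + (\<integral>x. (\<phi> x * D x $ i) *\<^sub>R u x \<partial>lebesgue)"
    by (subst Bochner_Integration.integral_add[OF i2 i1, symmetric])
      (simp add: algebra_simps)
  moreover have "(\<integral>x. (\<zeta> x *\<^sub>R U x + u x *\<^sub>R D x) $ i * \<phi> x \<partial>lebesgue)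
      = (\<integral>x. (\<zeta> x * \<phi> x) *\<^sub>R U x $ i \<partial>lebesgue) + (\<integral>x. (\<phi> x * D x $ i) *\<^sub>R u x \<partial>lebesgue)"
    by (subst Bochner_Integration.integral_add[OF i3 i1, symmetric])
      (simp add: algebra_simps)
  ultimately show "(\<integral>x. \<zeta> x * u x * E x $ i \<partial>lebesgue)
      = - (\<integral>x. (\<zeta> x *\<^sub>R U x + u x *\<^sub>R D x) $ i * \<phi> x \<partial>lebesgue)"
    by (simp add: mult_ac)
qed

lemma powr_add_le:
  fixes a b p :: real
  assumes "0 \<le> a" "0 \<le> b" "0 \<le> p"
  shows "(a + b) powr p \<le> 2 powr p * (a powr p + b powr p)"
proof -
  have "(a + b) powr p \<le> (2 * max a b) powr p"
    using assms by (intro powr_mono2) auto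
  also have "\<dots> = 2 powr p * max a b powr p"
    using assms by (simp add: powr_mult)
  also have "max a b powr p \<le> a powr p + b powr p"
    by (auto simp: max_def)
  finally show ?thesis by (simp add: mult_left_mono)
qed

lemma W1p_mult_test:
  fixes u :: "real ^ 'n \<Rightarrow> real"
  assumes "0 \<le> p" "W1p_loc p u U" "C1_test_function \<zeta> D"
  shows "W1p p (\<lambda>x. \<zeta> x * u x) (\<lambda>x. \<zeta> x *\<^sub>R U x + u x *\<^sub>R D x)"
proof -
  obtain K where K: "compact K" "\<And>x. x \<notin> K \<Longrightarrow> \<zeta> x = 0" "\<And>x. x \<notin> K \<Longrightarrow> D x = 0"
    using C1_test_function_support[OF assms(3)] by metis
  note cont = C1_test_function_continuous[OF assms(3)]
  obtain A where A: "0 \<le> A" "\<And>x. norm (\<zeta> x) \<le> A"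
    using continuous_compact_support_bounded[OF cont(1) K(1,2)] by metis
  obtain B where B: "0 \<le> B" "\<And>x. norm (D x) \<le> B"
    using continuous_compact_support_bounded[OF cont(2) K(1,3)] by metis
  have [measurable]: "u \<in> borel_measurable lebesgue" "U \<in> borel_measurable lebesgue"
      "\<zeta> \<in> borel_measurable lebesgue" "D \<in> borel_measurable lebesgue"
    using assms(2) cont by (auto simp: W1p_loc_def Lp_loc_function_def
        intro!: borel_measurable_lebesgue_continuous)
  have iu: "integrable lebesgue (\<lambda>x. indicator K x * norm (u x) powr p)"
    and iU: "integrable lebesgue (\<lambda>x. indicator K x * norm (U x) powr p)"
    using assms(2) K(1) by (auto simp: W1p_loc_def Lp_loc_function_def set_integrable_def)
  have "integrable lebesgue (\<lambda>x. norm (\<zeta> x * u x) powr p)"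
  proof (rule Bochner_Integration.integrable_bound)
    show "integrable lebesgue (\<lambda>x. A powr p * (indicator K x * norm (u x) powr p))"
      using iu by (rule integrable_mult_right)
    have "norm (\<zeta> x * u x) powr p \<le> A powr p * (indicator K x * norm (u x) powr p)" for x
      using A assms(1) K(2)[of x]
      by (cases "x \<in> K") (auto simp: abs_mult powr_mult intro!: mult_right_mono powr_mono2)
    then show "AE x in lebesgue. norm (norm (\<zeta> x * u x) powr p)
        \<le> norm (A powr p * (indicator K x * norm (u x) powr p))"
      by (intro AE_I2) (simp add: abs_mult)
  qed measurable
  moreover have "integrable lebesgue (\<lambda>x. norm (\<zeta> x *\<^sub>R U x + u x *\<^sub>R D x) powr p)"
  proof (rule Bochner_Integration.integrable_bound)
    let ?h = "\<lambda>x. 2 powr p * (A powr p * (indicator K x * norm (U x) powr p)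
        + B powr p * (indicator K x * norm (u x) powr p))"
    show "integrable lebesgue ?h"
      using iu iU by (intro integrable_mult_right Bochner_Integration.integrable_add)
    have "norm (\<zeta> x *\<^sub>R U x + u x *\<^sub>R D x) powr p \<le> ?h x" for x
    proof (cases "x \<in> K")
      case True
      have "norm (\<zeta> x *\<^sub>R U x + u x *\<^sub>R D x) \<le> A * norm (U x) + B * norm (u x)"
        using A(2)[of x] B(2)[of x]
        by (intro order.trans[OF norm_triangle_ineq] add_mono)
          (auto intro: mult_right_mono simp: mult.commute[of B] intro!: mult_left_mono)
      then have "norm (\<zeta> x *\<^sub>R U x + u x *\<^sub>R D x) powr p \<le> (A * norm (U x) + B * norm (u x)) powr p"
        using assms(1) by (intro powr_mono2) auto
      also have "\<dots> \<le> 2 powr p * ((A * norm (U x)) powr p + (B * norm (u x)) powr p)"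
        using A B assms(1) by (intro powr_add_le) auto
      finally show ?thesis using True A B by (simp add: powr_mult)
    qed (use K in auto)
    then show "AE x in lebesgue. norm (norm (\<zeta> x *\<^sub>R U x + u x *\<^sub>R D x) powr p) \<le> norm (?h x)"
      by (intro AE_I2) (smt (verit) powr_ge_zero real_norm_def)
  qed measurable
  ultimately show ?thesis
    using weak_gradient_mult_test[OF _ assms(3)] assms(2)
    by (auto simp: W1p_def W1p_loc_def Lp_function_def)
qed

section \<open>The Caccioppoli inequality\<close>

text \<open>If $L Y \le c X$, the first term on the right dominates the left-hand side; otherwise
  $X < (L/c) Y$, and the second one does.\<close>

lemma weighted_young:
  fixes p c L X Y :: real
  assumes "1 < p" "0 < c" "0 \<le> L" "0 \<le> X" "0 \<le> Y"
  shows "L * X powr (p - 1) * Y \<le> c * X powr p + L * (L / c) powr (p - 1) * Y powr p"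
proof (cases "L * Y \<le> c * X")
  case True
  have "L * X powr (p - 1) * Y \<le> c * X * X powr (p - 1)"
    using mult_right_mono[OF True, of "X powr (p - 1)"] by (simp add: mult_ac)
  also have "\<dots> = c * X powr p"
    using assms by (cases "X = 0") (auto simp: powr_diff)
  finally show ?thesis using assms by (smt (verit) mult_nonneg_nonneg powr_ge_zero)
next
  case False
  then have X: "X \<le> (L / c) * Y" using assms by (simp add: field_simps)
  have "X powr (p - 1) \<le> ((L / c) * Y) powr (p - 1)"
    using X assms by (intro powr_mono2) auto
  also have "\<dots> = (L / c) powr (p - 1) * Y powr (p - 1)"
    using assms powr_mult[of "L / c" Y "p - 1"] by simp
  finally have "L * X powr (p - 1) * Y \<le> L * ((L / c) powr (p - 1) * Y powr (p - 1)) * Y"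
    using assms by (intro mult_right_mono mult_left_mono) auto
  also have "\<dots> = L * (L / c) powr (p - 1) * Y powr p"
    using assms by (cases "Y = 0") (auto simp: powr_diff)
  finally show ?thesis using assms by (smt (verit) mult_nonneg_nonneg powr_ge_zero)
qed

text \<open>Along the ray through \<open>\<xi>\<close>, ellipticity gives
  $\frac{d}{dt} \langle a(x, t\xi), \xi\rangle \ge \lambda t^{p-2} |\xi|^p$. Integrating from
  \<open>0\<close>, where the growth bound makes \<open>a x (t *\<^sub>R \<xi>)\<close> vanish, yields the constant
  $\lambda/(p-1)$. As \<open>a x\<close> may fail to be differentiable at \<open>0\<close>, the argument compares \<open>t\<close>
  with \<open>1\<close> and lets \<open>t\<close> tend to \<open>0\<close> from the right.\<close>

lemma structural_coercivity:
  assumes "1 < p" "structural_conditions p lam \<Lambda> L0 \<omega> a"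
  shows "lam / (p - 1) * norm \<xi> powr p \<le> a x \<xi> \<bullet> \<xi>"
proof (cases "\<xi> = 0")
  case True
  then show ?thesis using assms by (simp add: structural_conditions_def)
next
  case False
  obtain Da where Da: "\<And>\<xi>. \<xi> \<noteq> 0 \<Longrightarrow> (a x has_derivative blinfun_apply (Da \<xi>)) (at \<xi>)"
      "\<And>\<xi>. \<xi> \<noteq> 0 \<Longrightarrow> norm (a x \<xi>) + norm (Da \<xi>) * norm \<xi> \<le> \<Lambda> * norm \<xi> powr (p - 1)"
      "\<And>\<xi> \<eta>. \<xi> \<noteq> 0 \<Longrightarrow> lam * norm \<xi> powr (p - 2) * (norm \<eta>)\<^sup>2 \<le> blinfun_apply (Da \<xi>) \<eta> \<bullet> \<eta>"
    using assms(2) unfolding structural_conditions_def by metis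
  define k where "k = lam * norm \<xi> powr p"
  define f where "f = (\<lambda>t. a x (t *\<^sub>R \<xi>) \<bullet> \<xi> - k * (t powr (p - 1) / (p - 1)))"
  define f' where "f' = (\<lambda>t. blinfun_apply (Da (t *\<^sub>R \<xi>)) \<xi> \<bullet> \<xi> - k * t powr (p - 2))"
  have df: "(f has_real_derivative f' t) (at t)" if "0 < t" for t
  proof -
    have "((\<lambda>t. a x (t *\<^sub>R \<xi>)) has_derivative (\<lambda>h. blinfun_apply (Da (t *\<^sub>R \<xi>)) (h *\<^sub>R \<xi>))) (at t)"
      using that False
      by (intro has_derivative_compose[of "\<lambda>t. t *\<^sub>R \<xi>" "\<lambda>h. h *\<^sub>R \<xi>" t UNIV "a x"] Da)
        (auto intro!: derivative_eq_intros)
    then have "((\<lambda>t. a x (t *\<^sub>R \<xi>) \<bullet> \<xi>) has_real_derivative blinfun_apply (Da (t *\<^sub>R \<xi>)) \<xi> \<bullet> \<xi>) (at t)"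
      unfolding has_field_derivative_def
      by (auto intro!: derivative_eq_intros simp: fun_eq_iff blinfun.scaleR_right)
    moreover have "((\<lambda>t. t powr (p - 1) / (p - 1)) has_real_derivative t powr (p - 2)) (at t)"
      using DERIV_cdivide[OF has_real_derivative_powr[OF that, of "p - 1"], of "p - 1"] that assms(1)
      by simp
    ultimately show ?thesis
      unfolding f_def f'_def by (intro DERIV_diff DERIV_cmult)
  qed
  have f'0: "0 \<le> f' t" if "0 < t" for t
  proof -
    have "lam * norm (t *\<^sub>R \<xi>) powr (p - 2) * (norm \<xi>)\<^sup>2 \<le> blinfun_apply (Da (t *\<^sub>R \<xi>)) \<xi> \<bullet> \<xi>"
      using that False by (intro Da) auto
    moreover have "norm (t *\<^sub>R \<xi>) powr (p - 2) * (norm \<xi>)\<^sup>2 = norm \<xi> powr p * t powr (p - 2)"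
      using that False by (simp add: powr_mult powr_diff)
    ultimately show ?thesis by (simp add: f'_def k_def mult_ac)
  qed
  have mono: "f t \<le> f 1" if "0 < t" "t \<le> 1" for t
    using \<open>t \<le> 1\<close>
  proof (rule DERIV_nonneg_imp_nondecreasing)
    fix s assume "t \<le> s" "s \<le> 1"
    then show "\<exists>y. DERIV f s :> y \<and> 0 \<le> y"
      using df[of s] f'0[of s] \<open>0 < t\<close> by (intro exI[of _ "f' s"]) simp
  qed
  have "(f \<longlongrightarrow> 0) (at_right 0)"
  proof -
    have z: "((\<lambda>t::real. t powr (p - 1)) \<longlongrightarrow> 0) (at_right 0)"
    proof (rule tendsto_eq_rhs[OF tendsto_powr'])
      show "((\<lambda>t::real. t) \<longlongrightarrow> 0) (at_right 0)" "((\<lambda>t::real. p - 1) \<longlongrightarrow> p - 1) (at_right 0)"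
        by (rule tendsto_intros)+
      show "0 \<noteq> (0::real) \<or> 0 < p - 1 \<and> (\<forall>\<^sub>F t::real in at_right 0. 0 \<le> t)"
        using assms(1) eventually_at_right_less[of "0::real"]
        by (auto elim!: eventually_mono)
    qed simp
    have "((\<lambda>t. a x (t *\<^sub>R \<xi>) \<bullet> \<xi>) \<longlongrightarrow> 0) (at_right 0)"
    proof (rule tendsto_0_le[where K = "\<Lambda> * norm \<xi> powr (p - 1) * norm \<xi>"])
      show "((\<lambda>t::real. t powr (p - 1)) \<longlongrightarrow> 0) (at_right 0)" by fact
      show "\<forall>\<^sub>F t in at_right 0. norm (a x (t *\<^sub>R \<xi>) \<bullet> \<xi>)
          \<le> norm (t powr (p - 1)) * (\<Lambda> * norm \<xi> powr (p - 1) * norm \<xi>)"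
        using eventually_at_right_less[of "0::real"]
      proof eventually_elim
        case (elim t)
        have "norm (a x (t *\<^sub>R \<xi>)) \<le> \<Lambda> * norm (t *\<^sub>R \<xi>) powr (p - 1)"
          using Da(2)[of "t *\<^sub>R \<xi>"] elim False
          by (smt (verit) mult_nonneg_nonneg norm_ge_zero scaleR_eq_0_iff)
        then have "norm (a x (t *\<^sub>R \<xi>)) * norm \<xi> \<le> \<Lambda> * norm (t *\<^sub>R \<xi>) powr (p - 1) * norm \<xi>"
          by (intro mult_right_mono) auto
        then show ?case
          using Cauchy_Schwarz_ineq2[of "a x (t *\<^sub>R \<xi>)" \<xi>] elim
          by (simp add: powr_mult mult_ac)
      qed
    qed
    from tendsto_diff[OF this tendsto_mult[OF tendsto_const[of k] tendsto_divide[OF z tendsto_const[of "p - 1"]]]]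
    show ?thesis using assms(1) by (simp add: f_def)
  qed
  then have "0 \<le> f 1"
  proof (rule tendsto_upperbound)
    show "\<forall>\<^sub>F t in at_right 0. f t \<le> f 1"
      using eventually_at_right_real[of 0 1] by (auto elim!: eventually_mono intro: mono)
  qed simp
  then show ?thesis by (simp add: f_def k_def)
qed

lemma structural_growth:
  assumes "structural_conditions p lam \<Lambda> L0 \<omega> a" "0 \<le> \<Lambda>"
  shows "norm (a x \<xi>) \<le> \<Lambda> * norm \<xi> powr (p - 1)"
proof (cases "\<xi> = 0")
  case True
  then show ?thesis using assms by (simp add: structural_conditions_def)
next
  case False
  then obtain d :: real where "0 \<le> d" "norm (a x \<xi>) + d * norm \<xi> \<le> \<Lambda> * norm \<xi> powr (p - 1)"
    using assms(1) unfolding structural_conditions_def by (metis norm_ge_zero)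
  then show ?thesis by (smt (verit) mult_nonneg_nonneg norm_ge_zero)
qed

text \<open>Test with \<open>\<zeta> u\<close>. Coercivity turns $\zeta \langle a(x,\nabla u), \nabla u\rangle$ into a
  multiple of $\zeta |\nabla u|^p$, which absorbs the gradient part of
  $u \langle a(x,\nabla u), D\zeta\rangle$ by Young's inequality; what remains is
  $u^p$ on the support of \<open>D\<close>. The integral of \<open>f u \<zeta>\<close> is all that is kept on the left.\<close>

lemma energy_inequality:
  fixes u \<zeta> :: "real ^ 'n \<Rightarrow> real" and U D :: "real ^ 'n \<Rightarrow> real ^ 'n"
  assumes "1 < p" "0 < lam" "0 \<le> \<Lambda>"
    and a: "structural_conditions p lam \<Lambda> L0 \<omega> a"
    and u: "\<And>x. 0 \<le> u x" "W1p_loc p u U"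
    and sol: "\<And>\<Psi> V. W1p p \<Psi> V \<Longrightarrow> compactly_supported \<Psi> \<Longrightarrow>
      integrable lebesgue (\<lambda>x. a x (U x) \<bullet> V x) \<and> integrable lebesgue (\<lambda>x. f x * \<Psi> x) \<and>
      (\<integral>x. a x (U x) \<bullet> V x \<partial>lebesgue) = - (\<integral>x. f x * \<Psi> x \<partial>lebesgue)"
    and \<zeta>: "C1_test_function \<zeta> D" "\<And>x. 0 \<le> \<zeta> x"
      "\<And>x. norm (D x) \<le> M * \<zeta> x powr ((p - 1) / p)"
    and S: "compact S" "\<And>x. D x \<noteq> 0 \<Longrightarrow> x \<in> S" and "0 \<le> M"
  shows "integrable lebesgue (\<lambda>x. f x * (\<zeta> x * u x))"
    and "(\<integral>x. f x * (\<zeta> x * u x) \<partial>lebesgue)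
      \<le> \<Lambda> * (\<Lambda> / (lam / (p - 1))) powr (p - 1) * M powr p * (\<integral>x. indicator S x * u x powr p \<partial>lebesgue)"
proof -
  define c where "c = lam / (p - 1)"
  have c: "0 < c" using assms(1,2) by (simp add: c_def)
  define k where "k = \<Lambda> * (\<Lambda> / c) powr (p - 1) * M powr p"
  let ?V = "\<lambda>x. \<zeta> x *\<^sub>R U x + u x *\<^sub>R D x"
  have "compactly_supported (\<lambda>x. \<zeta> x * u x)"
    using \<zeta>(1) by (fastforce simp: C1_test_function_def compactly_supported_def)
  moreover have "W1p p (\<lambda>x. \<zeta> x * u x) ?V"
    using assms(1) u(2) \<zeta>(1) by (intro W1p_mult_test) auto
  ultimately have *: "integrable lebesgue (\<lambda>x. a x (U x) \<bullet> ?V x)"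
      "integrable lebesgue (\<lambda>x. f x * (\<zeta> x * u x))"
      "(\<integral>x. a x (U x) \<bullet> ?V x \<partial>lebesgue) = - (\<integral>x. f x * (\<zeta> x * u x) \<partial>lebesgue)"
    using sol by blast+
  show "integrable lebesgue (\<lambda>x. f x * (\<zeta> x * u x))" by fact
  have iu: "integrable lebesgue (\<lambda>x. indicator S x * u x powr p)"
    using u S(1) by (auto simp: W1p_loc_def Lp_loc_function_def set_integrable_def)
  have pointwise: "- k * (indicator S x * u x powr p) \<le> a x (U x) \<bullet> ?V x" for x
  proof -
    have k: "0 \<le> k" using assms(3) by (simp add: k_def)
    have coer: "\<zeta> x * (c * norm (U x) powr p) \<le> \<zeta> x * (a x (U x) \<bullet> U x)"
      using structural_coercivity[OF assms(1) a, of "U x" x] \<zeta>(2)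
      by (intro mult_left_mono) (auto simp: c_def)
    have split: "a x (U x) \<bullet> ?V x = \<zeta> x * (a x (U x) \<bullet> U x) + u x * (a x (U x) \<bullet> D x)"
      by (simp add: inner_add_right)
    show ?thesis
    proof (cases "D x = 0")
      case True
      have "0 \<le> \<zeta> x * (c * norm (U x) powr p)" using c \<zeta>(2) by simp
      moreover have "0 \<le> k * (indicator S x * u x powr p)" using k by simp
      ultimately show ?thesis using coer split True by simp
    next
      case False
      have "u x * \<bar>a x (U x) \<bullet> D x\<bar> \<le> u x * (norm (a x (U x)) * norm (D x))"
        using u(1) by (intro mult_left_mono Cauchy_Schwarz_ineq2)
      also have "\<dots> \<le> u x * ((\<Lambda> * norm (U x) powr (p - 1)) * (M * \<zeta> x powr ((p - 1) / p)))"
        using u(1) \<zeta>(3) assms(3)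
        by (intro mult_left_mono mult_mono structural_growth[OF a]) auto
      \<comment> \<open>The weight $\zeta^{(p-1)/p}$ is distributed so that $X = |\nabla u| \zeta^{1/p}$ satisfies
        $X^p = \zeta |\nabla u|^p$, the quantity that coercivity controls.\<close>
      also have "\<dots> = \<Lambda> * (norm (U x) * \<zeta> x powr (1 / p)) powr (p - 1) * (u x * M)"
        using \<zeta>(2) by (simp add: powr_mult powr_powr)
      also have "\<dots> \<le> c * (norm (U x) * \<zeta> x powr (1 / p)) powr p
          + \<Lambda> * (\<Lambda> / c) powr (p - 1) * (u x * M) powr p"
        using assms(1,3) c u(1) \<open>0 \<le> M\<close> by (intro weighted_young) auto
      also have "\<dots> = \<zeta> x * (c * norm (U x) powr p) + k * u x powr p"
        using \<zeta>(2) assms(1) u(1) \<open>0 \<le> M\<close> by (simp add: powr_mult powr_powr k_def)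
      finally have "u x * \<bar>a x (U x) \<bullet> D x\<bar> \<le> \<zeta> x * (c * norm (U x) powr p) + k * u x powr p" .
      moreover have "- (u x * \<bar>a x (U x) \<bullet> D x\<bar>) \<le> u x * (a x (U x) \<bullet> D x)"
        using mult_left_mono[OF abs_ge_minus_self[of "a x (U x) \<bullet> D x"] u(1)[of x]] by simp
      ultimately show ?thesis using coer split S(2)[OF False] by simp
    qed
  qed
  have "(\<integral>x. - k * (indicator S x * u x powr p) \<partial>lebesgue) \<le> (\<integral>x. a x (U x) \<bullet> ?V x \<partial>lebesgue)"
    using iu *(1) pointwise by (intro integral_mono) (auto intro!: integrable_mult_right)
  then show "(\<integral>x. f x * (\<zeta> x * u x) \<partial>lebesgue)
      \<le> \<Lambda> * (\<Lambda> / (lam / (p - 1))) powr (p - 1) * M powr p * (\<integral>x. indicator S x * u x powr p \<partial>lebesgue)"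
    using *(3) by (simp add: k_def c_def)
qed

text \<open>The factor $R^{-p}$ comes from the cutoff gradient, of size $C/R$. The integral on the
  right extends over the annulus only, which is what allows a hypothesis at infinity to be
  used.\<close>

lemma ball_energy_bound:
  fixes u f :: "real ^ 'n \<Rightarrow> real" and U :: "real ^ 'n \<Rightarrow> real ^ 'n"
  assumes p: "1 < p" and lam: "0 < lam" and \<Lambda>: "0 \<le> \<Lambda>"
    and a: "structural_conditions p lam \<Lambda> L0 \<omega> a"
    and u0: "\<And>x. 0 \<le> u x" and U: "W1p_loc p u U"
    and f: "f \<in> borel_measurable lebesgue" "\<And>x. 0 \<le> f x"
    and sol: "\<And>\<Psi> V. W1p p \<Psi> V \<Longrightarrow> compactly_supported \<Psi> \<Longrightarrow>
      integrable lebesgue (\<lambda>x. a x (U x) \<bullet> V x) \<and> integrable lebesgue (\<lambda>x. f x * \<Psi> x) \<and>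
      (\<integral>x. a x (U x) \<bullet> V x \<partial>lebesgue) = - (\<integral>x. f x * \<Psi> x \<partial>lebesgue)"
  obtains k where "0 \<le> k"
    and "\<And>R. 0 < R \<Longrightarrow> integrable lebesgue (\<lambda>x. indicator (cball 0 R) x * (f x * u x))"
    and "\<And>R. 0 < R \<Longrightarrow> (\<integral>x. indicator (cball 0 R) x * (f x * u x) \<partial>lebesgue)
      \<le> k / R powr p * (\<integral>x. indicator (cball 0 (2 * R) - ball 0 R) x * u x powr p \<partial>lebesgue)"
proof -
  define F where "F = (\<lambda>x. f x * u x)"
  have F0: "0 \<le> F x" for x by (simp add: F_def f u0)
  have [measurable]: "u \<in> borel_measurable lebesgue" "f \<in> borel_measurable lebesgue"
    using U f by (auto simp: W1p_loc_def Lp_loc_function_def)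
  have F_meas [measurable]: "F \<in> borel_measurable lebesgue"
    unfolding F_def by measurable
  have cball_meas [measurable]: "cball (0 :: real ^ 'n) R \<in> sets lebesgue" for R
    by (simp add: fmeasurableD)
  obtain C where C: "0 < C"
    and cutoff: "\<And>R. 0 < R \<Longrightarrow> \<exists>\<zeta> (D :: real ^ 'n \<Rightarrow> real ^ 'n). C1_test_function \<zeta> D \<and>
      (\<forall>x. 0 \<le> \<zeta> x) \<and> (\<forall>x. norm x \<le> R \<longrightarrow> \<zeta> x = 1) \<and>
      (\<forall>x. D x \<noteq> 0 \<longrightarrow> R \<le> norm x \<and> norm x \<le> 2 * R) \<and>
      (\<forall>x. norm (D x) \<le> C / R * \<zeta> x powr ((p - 1) / p))"
    using cutoff_exists[OF p] by metis
  define k where "k = \<Lambda> * (\<Lambda> / (lam / (p - 1))) powr (p - 1) * C powr p"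
  have k: "0 \<le> k" using \<Lambda> by (simp add: k_def)
  define A where "A = (\<lambda>R. cball (0 :: real ^ 'n) (2 * R) - ball 0 R)"
  have energy: "integrable lebesgue (\<lambda>x. indicator (cball 0 R) x * F x) \<and>
      (\<integral>x. indicator (cball 0 R) x * F x \<partial>lebesgue)
        \<le> k / R powr p * (\<integral>x. indicator (A R) x * u x powr p \<partial>lebesgue)" if R: "0 < R" for R
  proof -
    obtain \<zeta> and D :: "real ^ 'n \<Rightarrow> real ^ 'n" where \<zeta>: "C1_test_function \<zeta> D" "\<And>x. 0 \<le> \<zeta> x"
      "\<And>x. norm x \<le> R \<Longrightarrow> \<zeta> x = 1" "\<And>x. D x \<noteq> 0 \<Longrightarrow> R \<le> norm x \<and> norm x \<le> 2 * R"
      "\<And>x. norm (D x) \<le> C / R * \<zeta> x powr ((p - 1) / p)"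
      using cutoff[OF R] by blast
    have "compact (A R)" unfolding A_def by (intro compact_diff) auto
    moreover have "x \<in> A R" if "D x \<noteq> 0" for x
      using \<zeta>(4)[OF that] by (auto simp: A_def)
    moreover have "0 \<le> C / R" using C R by auto
    ultimately have E: "integrable lebesgue (\<lambda>x. f x * (\<zeta> x * u x))"
        "(\<integral>x. f x * (\<zeta> x * u x) \<partial>lebesgue) \<le> \<Lambda> * (\<Lambda> / (lam / (p - 1))) powr (p - 1) * (C / R) powr p
          * (\<integral>x. indicator (A R) x * u x powr p \<partial>lebesgue)"
      using energy_inequality[OF p lam \<Lambda> a u0 U sol \<zeta>(1,2,5), of "A R"] by blast+
    have le: "indicator (cball 0 R) x * F x \<le> f x * (\<zeta> x * u x)" for x
      using F0[of x] \<zeta>(2)[of x] \<zeta>(3)[of x] by (auto simp: indicator_def F_def f(2) u0)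
    have int: "integrable lebesgue (\<lambda>x. indicator (cball 0 R) x * F x)"
    proof (rule Bochner_Integration.integrable_bound[OF E(1)])
      show "AE x in lebesgue. norm (indicator (cball 0 R) x * F x) \<le> norm (f x * (\<zeta> x * u x))"
        using le F0 by (intro AE_I2) (smt (verit) indicator_pos_le mult_nonneg_nonneg real_norm_def)
    qed measurable
    then have "(\<integral>x. indicator (cball 0 R) x * F x \<partial>lebesgue) \<le> (\<integral>x. f x * (\<zeta> x * u x) \<partial>lebesgue)"
      using E(1) le by (intro integral_mono) auto
    then show ?thesis
      using E(2) int C R by (simp add: k_def powr_divide)
  qed
  show thesis
    using that[OF k] energy by (auto simp: F_def A_def)
qed

section \<open>Contraction under doubling forces vanishing\<close>

text \<open>After \<open>k\<close> doublings the contraction gains \<open>2\<^bsup>-k(N+1)\<^esup>\<close>, while the growth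
  bound loses only \<open>2\<^bsup>kN\<^esup>\<close>.\<close>

lemma doubling_contraction_zero:
  fixes I :: "real \<Rightarrow> real"
  assumes "0 < R\<^sub>0" "\<And>R. 0 \<le> I R"
    and contr: "\<And>R. R\<^sub>0 \<le> R \<Longrightarrow> I R \<le> (1 / 2) ^ Suc N * I (2 * R)"
    and growth: "\<And>R. R\<^sub>0 \<le> R \<Longrightarrow> I R \<le> A * R ^ N"
    and "R\<^sub>0 \<le> R"
  shows "I R = 0"
proof -
  define d :: real where "d = (1 / 2) ^ Suc N"
  have ge: "R\<^sub>0 \<le> 2 ^ k * R" for k
  proof -
    have "1 * R \<le> 2 ^ k * R"
      using \<open>0 < R\<^sub>0\<close> \<open>R\<^sub>0 \<le> R\<close> by (intro mult_right_mono) auto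
    with \<open>R\<^sub>0 \<le> R\<close> show ?thesis by linarith
  qed
  have iter: "I R \<le> d ^ k * I (2 ^ k * R)" for k
  proof (induction k)
    case (Suc k)
    have "I (2 ^ k * R) \<le> d * I (2 ^ Suc k * R)"
      using contr[OF ge[of k]] by (simp only: power_Suc mult.assoc d_def)
    then have "d ^ k * I (2 ^ k * R) \<le> d ^ k * (d * I (2 ^ Suc k * R))"
      by (intro mult_left_mono) (auto simp: d_def)
    also have "\<dots> = d ^ Suc k * I (2 ^ Suc k * R)"
      by (simp only: power_Suc mult_ac)
    finally show ?case using Suc by linarith
  qed simp
  have "I R \<le> A * R ^ N * (1 / 2) ^ k" for k
  proof -
    have "(1 / 2 :: real) ^ k * 2 ^ k = 1"
      unfolding power_mult_distrib[symmetric] by simp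
    then have "((1 / 2 :: real) ^ k) ^ N * (2 ^ k) ^ N = 1"
      unfolding power_mult_distrib[symmetric] by simp
    moreover have "d ^ k = (1 / 2) ^ k * ((1 / 2) ^ k) ^ N"
      unfolding d_def power_mult[symmetric] power_add[symmetric] by (simp add: algebra_simps)
    ultimately have dk: "d ^ k * (2 ^ k) ^ N = (1 / 2) ^ k"
      by (simp only: mult.assoc mult.right_neutral)
    have "d ^ k * I (2 ^ k * R) \<le> d ^ k * (A * (2 ^ k * R) ^ N)"
      by (intro mult_left_mono growth ge) (simp add: d_def)
    also have "\<dots> = A * R ^ N * (d ^ k * (2 ^ k) ^ N)"
      by (simp only: power_mult_distrib mult_ac)
    finally show ?thesis using iter[of k] unfolding dk by linarith
  qed
  moreover have "(\<lambda>k. A * R ^ N * (1 / 2) ^ k) \<longlonglongrightarrow> A * R ^ N * 0"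
    by (intro tendsto_intros LIMSEQ_power_zero) auto
  ultimately have "I R \<le> 0"
    by (intro LIMSEQ_le_const[of _ 0]) auto
  with assms(2)[of R] show ?thesis by simp
qed

text \<open>A function bounded by $|x|^{N_0}$ at infinity has ball integrals of order at most
  $R^{N_0 + d}$ in dimension \<open>d\<close>; the contraction factor is chosen to beat this
  power.\<close>

lemma AE_zero_of_ball_integral_contraction:
  fixes F :: "'a::euclidean_space \<Rightarrow> real"
  assumes F0: "\<And>x. 0 \<le> F x"
    and int: "\<And>R. R0 \<le> R \<Longrightarrow> integrable lebesgue (\<lambda>x. indicator (cball 0 R) x * F x)"
    and R0: "1 \<le> R0"
    and bound: "\<And>x. R0 \<le> norm x \<Longrightarrow> F x \<le> norm x ^ N0"
    and contr: "\<And>R. R0 \<le> R \<Longrightarrow> (\<integral>x. indicator (cball 0 R) x * F x \<partial>lebesgue)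
      \<le> (1 / 2) ^ Suc (N0 + DIM('a)) * (\<integral>x. indicator (cball 0 (2 * R)) x * F x \<partial>lebesgue)"
  shows "AE x in lebesgue. F x = 0"
proof -
  define I where "I = (\<lambda>R. \<integral>x. indicator (cball 0 R) x * F x \<partial>lebesgue)"
  define N where "N = N0 + DIM('a)"
  have I0: "0 \<le> I R" for R
    unfolding I_def using F0 by (intro integral_nonneg_AE) simp
  define v where "v = measure lebesgue (cball (0 :: 'a) 1)"
  have growth: "I R \<le> (I R0 + v) * R ^ N" if R: "R0 \<le> R" for R
  proof -
    have le: "indicator (cball 0 R) x * F x
        \<le> indicator (cball 0 R0) x * F x + R ^ N0 * indicator (cball 0 R) x" for x
    proof (cases "R0 < norm x \<and> norm x \<le> R")
      case True
      then have "F x \<le> norm x ^ N0" using bound[of x] by simp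
      also have "\<dots> \<le> R ^ N0"
        using True by (intro power_mono) auto
      finally show ?thesis using True by simp
    next
      case False
      then show ?thesis using F0[of x] R R0 by (auto simp: indicator_def)
    qed
    have i1: "integrable lebesgue (\<lambda>x. indicator (cball 0 R0) x * F x)"
        "integrable lebesgue (\<lambda>x. indicator (cball 0 R) x * F x)"
      using int R by auto
    have "emeasure lborel (cball (0 :: 'a) R) < \<infinity>"
      by (intro emeasure_bounded_finite bounded_cball)
    then have i2: "integrable lebesgue (\<lambda>x. R ^ N0 * indicator (cball (0 :: 'a) R) x)"
      by (intro integrable_mult_right integrable_real_indicator) (auto simp: emeasure_completion)
    have "I R \<le> (\<integral>x. indicator (cball 0 R0) x * F x + R ^ N0 * indicator (cball 0 R) x \<partial>lebesgue)"
      unfolding I_def using i1 i2 le by (intro integral_mono Bochner_Integration.integrable_add)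
    also have "\<dots> = I R0 + R ^ N0 * measure lebesgue (cball (0 :: 'a) R)"
      using i1 i2 by (simp add: I_def)
    also have "measure lebesgue (cball (0 :: 'a) R) = v * R ^ DIM('a)"
      using R R0 by (simp add: v_def content_cball)
    also have "I R0 + R ^ N0 * (v * R ^ DIM('a)) \<le> I R0 * R ^ N + R ^ N0 * (v * R ^ DIM('a))"
      using I0[of R0] R R0 by (intro add_mono mult_le_cancel_left1[THEN iffD2]) auto
    also have "\<dots> = (I R0 + v) * R ^ N"
      by (simp add: N_def power_add algebra_simps)
    finally show ?thesis .
  qed
  have I_zero: "I R = 0" if "R0 \<le> R" for R
  proof (rule doubling_contraction_zero[of R0 I N "I R0 + v"])
    show "I R \<le> (1 / 2) ^ Suc N * I (2 * R)" if "R0 \<le> R" for R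
      using contr[OF that] by (simp only: I_def N_def)
  qed (use growth I0 R0 that in auto)
  have "AE x in lebesgue. indicator (cball 0 (real n + R0)) x * F x = 0" for n
  proof -
    have "integrable lebesgue (\<lambda>x. indicator (cball 0 (real n + R0)) x * F x)"
      by (rule int) simp
    from integral_nonneg_eq_0_iff_AE[OF this] I_zero[of "real n + R0"] F0
    show ?thesis by (simp add: I_def)
  qed
  then have "AE x in lebesgue. \<forall>n. indicator (cball 0 (real n + R0)) x * F x = 0"
    unfolding AE_all_countable by (rule allI)
  then show ?thesis
  proof eventually_elim
    case (elim x)
    obtain n where "norm x \<le> real n" using real_arch_simple by blast
    then have "x \<in> cball 0 (real n + R0)" using R0 by simp
    then show ?case using elim[rule_format, of n] by simp
  qed
qed

lemma AE_zero_imp_continuous_zero: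
  fixes u :: "'a::euclidean_space \<Rightarrow> real"
  assumes "AE x in lebesgue. u x = 0" "continuous_on UNIV u"
  shows "u x = 0"
proof (rule ccontr)
  assume "u x \<noteq> 0"
  have "open {x. u x \<noteq> 0}"
    using open_vimage[OF _ assms(2), of "- {0}"] by (simp add: vimage_def open_Compl)
  moreover have "negligible {x. u x \<noteq> 0}"
    using assms(1) by (simp add: AE_iff_null_sets negligible_iff_null_sets calculation)
  ultimately show False using open_not_negligible \<open>u x \<noteq> 0\<close> by blast
qed

section \<open>The Liouville theorem\<close>

text \<open>Scaling identifies the critical exponent: $u^p = u^{p-1-m} u^{m+1}$, and the decay
  hypothesis bounds the first factor by $\varepsilon^{p-1-m} r^{p+\alpha}$.\<close>

lemma decay_absorption:
  fixes u r \<epsilon> p \<alpha> m :: real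
  assumes "0 \<le> u" "0 < r" "0 \<le> \<epsilon>" "m < p - 1"
    and "u \<le> \<epsilon> * r powr (1 + (1 + \<alpha> + m) / (p - 1 - m))"
  shows "u powr p \<le> \<epsilon> powr (p - 1 - m) * r powr p * (r powr \<alpha> * u powr m * u)"
proof (cases "u = 0")
  case False
  let ?\<beta> = "1 + (1 + \<alpha> + m) / (p - 1 - m)"
  have \<beta>: "?\<beta> * (p - 1 - m) = p + \<alpha>"
    using assms(4) by (simp add: field_simps)
  have "u powr (p - 1 - m) \<le> (\<epsilon> * r powr ?\<beta>) powr (p - 1 - m)"
    using assms by (intro powr_mono2) auto
  also have "\<dots> = \<epsilon> powr (p - 1 - m) * r powr (?\<beta> * (p - 1 - m))"
    using assms by (simp add: powr_mult powr_powr)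
  also have "\<dots> = \<epsilon> powr (p - 1 - m) * (r powr p * r powr \<alpha>)"
    unfolding \<beta> by (simp add: powr_add)
  finally have "u powr (p - 1 - m) * (u powr m * u) \<le> \<epsilon> powr (p - 1 - m) * (r powr p * r powr \<alpha>) * (u powr m * u)"
    using assms by (intro mult_right_mono) auto
  moreover have "u powr (p - 1 - m) * (u powr m * u) = u powr p"
    using False assms(1) by (simp add: powr_diff)
  ultimately show ?thesis by (simp add: mult_ac)
qed (use assms in simp)

theorem theorem1p17:
  fixes a :: "real ^ 'n \<Rightarrow> real ^ 'n \<Rightarrow> real ^ 'n"
    and u :: "real ^ 'n \<Rightarrow> real"
    and \<omega> :: "real \<Rightarrow> real"
    and p lam \<Lambda> L0 \<alpha> \<sigma> m :: real
  assumes "2 \<le> CARD('n)"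
    and "1 < p" and "0 < lam" and "lam \<le> \<Lambda>" and "0 < L0"
    and "modulus_of_continuity \<omega>"
    and "\<bar>\<alpha>\<bar> < \<sigma>" and "\<exists>C. \<forall>s\<ge>0. \<omega> s \<le> C * s powr (1 + \<sigma>)"
    and "structural_conditions p lam \<Lambda> L0 \<omega> a"
    and "0 \<le> m" and "m < p - 1" and "0 < \<alpha> + 1 + m"
    and "\<forall>x. 0 \<le> u x"
    and "entire_weak_solution p a \<alpha> m u"
    and "u 0 = 0"
    and "((\<lambda>x. u x / norm x powr (1 + (1 + \<alpha> + m) / (p - 1 - m))) \<longlongrightarrow> 0) at_infinity"
  shows "(AE x in lebesgue. u x = 0) \<and> (continuous_on UNIV u \<longrightarrow> (\<forall>x. u x = 0))"
proof -
  define \<beta> where "\<beta> = 1 + (1 + \<alpha> + m) / (p - 1 - m)"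
  define f where "f = (\<lambda>x. norm x powr \<alpha> * u x powr m)"
  define F where "F = (\<lambda>x. f x * u x)"
  define I where "I = (\<lambda>R. \<integral>x. indicator (cball 0 R) x * F x \<partial>lebesgue)"
  obtain U where U: "W1p_loc p u U"
    and sol: "\<And>\<Psi> V. W1p p \<Psi> V \<Longrightarrow> compactly_supported \<Psi> \<Longrightarrow>
      integrable lebesgue (\<lambda>x. a x (U x) \<bullet> V x) \<and> integrable lebesgue (\<lambda>x. f x * \<Psi> x) \<and>
      (\<integral>x. a x (U x) \<bullet> V x \<partial>lebesgue) = - (\<integral>x. f x * \<Psi> x \<partial>lebesgue)"
    using \<open>entire_weak_solution p a \<alpha> m u\<close> unfolding entire_weak_solution_def f_def by blast
  have u0: "0 \<le> u x" for x using \<open>\<forall>x. 0 \<le> u x\<close> by blast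
  have F0: "0 \<le> F x" for x by (simp add: F_def f_def u0)
  have I0: "0 \<le> I R" for R
    unfolding I_def using F0 by (intro integral_nonneg_AE) simp
  have [measurable]: "u \<in> borel_measurable lebesgue" "(norm :: real ^ 'n \<Rightarrow> real) \<in> borel_measurable lebesgue"
    using U by (auto simp: W1p_loc_def Lp_loc_function_def
        intro!: borel_measurable_lebesgue_continuous continuous_intros)
  have "f \<in> borel_measurable lebesgue" unfolding f_def by measurable
  moreover have "0 \<le> f x" for x by (simp add: f_def)
  moreover have "0 \<le> \<Lambda>" using assms by linarith
  ultimately obtain k where k: "0 \<le> k"
    and energy: "\<And>R. 0 < R \<Longrightarrow> integrable lebesgue (\<lambda>x. indicator (cball 0 R) x * (f x * u x))"
      "\<And>R. 0 < R \<Longrightarrow> (\<integral>x. indicator (cball 0 R) x * (f x * u x) \<partial>lebesgue)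
        \<le> k / R powr p * (\<integral>x. indicator (cball 0 (2 * R) - ball 0 R) x * u x powr p \<partial>lebesgue)"
    using ball_energy_bound[OF \<open>1 < p\<close> \<open>0 < lam\<close> _ \<open>structural_conditions p lam \<Lambda> L0 \<omega> a\<close> u0 U _ _ sol]
    by blast
  define A where "A = (\<lambda>R. cball (0 :: real ^ 'n) (2 * R) - ball 0 R)"
  \<comment> \<open>The order of growth of \<open>F\<close> is fixed first; it determines the contraction factor \<open>\<delta>\<close>, and
    then \<open>\<epsilon>\<close> is taken so small that $k 2^p \varepsilon^{p-1-m} \le \delta$. The \<open>+ 1\<close> avoids
    division by zero if \<open>k = 0\<close>, and \<open>\<epsilon> \<le> 1\<close> lets the same decay bound serve for the
    growth estimate.\<close>
  obtain N0 :: nat where N0: "\<alpha> + \<beta> * (m + 1) \<le> N0"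
    using real_arch_simple by blast
  define \<delta> :: real where "\<delta> = (1 / 2) ^ Suc (N0 + CARD('n))"
  define \<epsilon> where "\<epsilon> = min 1 ((\<delta> / (k * 2 powr p + 1)) powr (1 / (p - 1 - m)))"
  have \<epsilon>: "0 < \<epsilon>" "\<epsilon> \<le> 1"
  proof -
    have "0 < k * 2 powr p + 1" using k by (simp add: add_nonneg_pos)
    moreover have "0 < \<delta>" by (simp add: \<delta>_def)
    ultimately show "0 < \<epsilon>" by (simp add: \<epsilon>_def)
  qed (simp add: \<epsilon>_def)
  have k\<epsilon>: "k * 2 powr p * \<epsilon> powr (p - 1 - m) \<le> \<delta>"
  proof -
    have pos: "0 < k * 2 powr p + 1" using k by (simp add: add_nonneg_pos)
    have "\<epsilon> powr (p - 1 - m) \<le> ((\<delta> / (k * 2 powr p + 1)) powr (1 / (p - 1 - m))) powr (p - 1 - m)"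
      using \<epsilon> assms by (intro powr_mono2) (auto simp: \<epsilon>_def)
    also have "\<dots> = \<delta> / (k * 2 powr p + 1)"
      using assms pos by (simp add: powr_powr \<delta>_def)
    finally have "(k * 2 powr p + 1) * \<epsilon> powr (p - 1 - m) \<le> \<delta>"
      using pos by (simp add: field_simps)
    moreover have "0 \<le> \<epsilon> powr (p - 1 - m)" by simp
    ultimately show ?thesis by (simp only: distrib_right mult_1_left)
  qed
  have "\<forall>\<^sub>F x in at_infinity. u x / norm x powr \<beta> < \<epsilon>"
    using order_tendstoD(2)[OF assms(16) \<open>0 < \<epsilon>\<close>] by (simp add: \<beta>_def)
  then obtain b where b: "\<And>x. b \<le> norm x \<Longrightarrow> u x / norm x powr \<beta> < \<epsilon>"
    by (auto simp: eventually_at_infinity)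
  define R0 where "R0 = max 1 b"
  have R0: "1 \<le> R0" by (simp add: R0_def)
  have decay: "u x \<le> \<epsilon> * norm x powr \<beta>" if "R0 \<le> norm x" for x
  proof -
    have "0 < norm x" using that R0 by linarith
    then show ?thesis using b[of x] that by (simp add: R0_def field_simps)
  qed
  have contr: "I R \<le> \<delta> * I (2 * R)" if R: "R0 \<le> R" for R
  proof -
    have Rpos: "0 < R" using R R0 by linarith
    have le: "indicator (A R) x * u x powr p
        \<le> \<epsilon> powr (p - 1 - m) * (2 * R) powr p * (indicator (cball 0 (2 * R)) x * F x)" for x
    proof (cases "x \<in> A R")
      case True
      then have x: "R \<le> norm x" "norm x \<le> 2 * R" by (auto simp: A_def)
      have "u x powr p \<le> \<epsilon> powr (p - 1 - m) * norm x powr p * F x"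
        unfolding F_def f_def using decay[of x] x R R0 \<epsilon> u0 assms
        by (intro decay_absorption) (auto simp: \<beta>_def)
      also have "\<dots> \<le> \<epsilon> powr (p - 1 - m) * (2 * R) powr p * F x"
        using x assms F0 by (intro mult_right_mono mult_left_mono powr_mono2) auto
      finally show ?thesis using True by (simp add: A_def)
    qed (use F0 in auto)
    have int: "integrable lebesgue (\<lambda>x. indicator (cball 0 (2 * R)) x * F x)"
      using energy(1)[of "2 * R"] Rpos by (simp add: F_def)
    have "(\<integral>x. indicator (A R) x * u x powr p \<partial>lebesgue) \<le>
        (\<integral>x. \<epsilon> powr (p - 1 - m) * (2 * R) powr p * (indicator (cball 0 (2 * R)) x * F x) \<partial>lebesgue)"
      using le int F0 by (intro integral_mono') auto
    also have "\<dots> = \<epsilon> powr (p - 1 - m) * (2 * R) powr p * I (2 * R)"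
      by (simp add: I_def)
    finally have "k / R powr p * (\<integral>x. indicator (A R) x * u x powr p \<partial>lebesgue)
        \<le> k / R powr p * (\<epsilon> powr (p - 1 - m) * (2 * R) powr p * I (2 * R))"
      using k by (intro mult_left_mono) auto
    also have "\<dots> = k * 2 powr p * \<epsilon> powr (p - 1 - m) * I (2 * R)"
      using Rpos by (simp add: powr_mult)
    also have "\<dots> \<le> \<delta> * I (2 * R)"
      using k\<epsilon> I0 by (rule mult_right_mono)
    finally show ?thesis using energy(2)[OF Rpos] by (simp add: I_def A_def F_def)
  qed
  have bound: "F x \<le> norm x ^ N0" if "R0 \<le> norm x" for x
  proof -
    have x: "1 \<le> norm x" using that R0 by linarith
    have "u x \<le> norm x powr \<beta>"
      using decay[of x] that \<epsilon> mult_right_mono[of \<epsilon> 1 "norm x powr \<beta>"] by auto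
    then have "F x \<le> norm x powr \<alpha> * (norm x powr \<beta>) powr m * norm x powr \<beta>"
      unfolding F_def f_def using u0[of x] \<open>0 \<le> m\<close>
      by (intro mult_mono[OF mult_left_mono[OF powr_mono2]]) auto
    also have "\<dots> = norm x powr (\<alpha> + \<beta> * (m + 1))"
      by (simp add: powr_powr powr_add algebra_simps)
    also have "\<dots> \<le> norm x powr N0"
      using x N0 by (intro powr_mono) auto
    also have "\<dots> = norm x ^ N0"
      using x by (intro powr_realpow) auto
    finally show ?thesis .
  qed
  have "AE x in lebesgue. F x = 0"
  proof (rule AE_zero_of_ball_integral_contraction[OF F0 _ R0 bound])
    show "integrable lebesgue (\<lambda>x. indicator (cball 0 R) x * F x)" if "R0 \<le> R" for R
      using energy(1)[of R] that R0 by (simp add: F_def)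
    show "(\<integral>x. indicator (cball 0 R) x * F x \<partial>lebesgue) \<le> (1 / 2) ^ Suc (N0 + DIM(real ^ 'n))
        * (\<integral>x. indicator (cball 0 (2 * R)) x * F x \<partial>lebesgue)" if "R0 \<le> R" for R
      using contr[OF that] by (simp add: I_def \<delta>_def)
  qed
  \<comment> \<open>At the origin \<open>F\<close> gives no information about \<open>u\<close>, because \<open>0 powr \<alpha> = 0\<close> for every
    \<open>\<alpha>\<close>.\<close>
  moreover have "AE x in lebesgue. x \<notin> {0 :: real ^ 'n}"
    by (intro AE_not_in) (simp flip: negligible_iff_null_sets)
  ultimately have "AE x in lebesgue. u x = 0"
    by eventually_elim (simp add: F_def f_def)
  then show ?thesis using AE_zero_imp_continuous_zero by blast
qed

end
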